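(* Let $d\ge2$ be a constant and let $s=|V|^{\alpha}$ for a constant $\alpha\in(0,1)$. For any implicit $(d,c)$-grid graph $G=(V,\mathcal{E})$ with $1\le c\le s^{1/d^3}$ and $|V|>s$, a pseudo $s$-separator $S$ of $G$ exists.
   Context: An implicit graph $G=(V,\mathcal{E})$ consists of a node set $V$, each node carrying $O(1)$ words of information, and an edge formation rule $\mathcal{E}$ deciding adjacency (and weight) of two distinct nodes from their information; it is an implicit $(d,c)$-grid graph if the resulting explicit graph has nodes in $\mathbb{N}^d$ and every edge $(u,v)$ satisfies $0<\|u-v\|_\infty\le c$. A pseudo $s$-separator of $G$ is a set $S\subseteq V$ such that $|S|\in O\!\left(\frac{c|V|}{s^{1/d}}\log s\right)$ and removing $S$ disconnects $G$ into $h\in O(|V|/s)$ induced subgraphs $G_i=(V_i,\mathcal{E})$, $i\in[1,h]$, with pairwise disjoint $V_i\subset V$ and $|V_i|\in O(s)$ (no edge of $G$ joins different $V_i$). Here $s$ is the MPC local memory size, $s=|V|^\alpha$. *)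

theory Defs
  imports "HOL-Analysis.Analysis"
begin

text \<open>
  A word is a natural number. The edge formation rule sees only the information of the two
  nodes; it returns \<open>None\<close> for non-adjacent nodes and \<open>Some w\<close> for an edge of weight \<open>w\<close>.
\<close>

record 'v implicit_graph =
  nodes :: "'v set"
  info :: "'v \<Rightarrow> nat list"
  edge_rule :: "nat list \<Rightarrow> nat list \<Rightarrow> real option"

text \<open>
  Edges are ordered pairs and the rule need not be symmetric, so directed graphs are covered;
  an undirected graph is the case of a symmetric rule.
\<close>

definition edges :: "'v implicit_graph \<Rightarrow> ('v \<times> 'v) set" where
  "edges G = {(u, v). u \<in> nodes G \<and> v \<in> nodes G \<and> u \<noteq> v \<and>
                      edge_rule G (info G u) (info G v) \<noteq> None}"

text \<open>
  Each node carries at most \<open>k\<close> words of \<open>b\<close> bits. The bound \<open>k\<close> is the constant behind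
  ``\<open>O(1)\<close> words''.
\<close>

definition is_implicit_graph :: "nat \<Rightarrow> nat \<Rightarrow> 'v implicit_graph \<Rightarrow> bool" where
  "is_implicit_graph k b G \<longleftrightarrow>
     finite (nodes G) \<and>
     (\<forall>v \<in> nodes G. length (info G v) \<le> k \<and> (\<forall>x \<in> set (info G v). x < 2 ^ b))"

definition grid_dist :: "nat ^ 'd \<Rightarrow> nat ^ 'd \<Rightarrow> real" where
  "grid_dist u v = infnorm ((\<chi> i. real (u $ i) - real (v $ i)) :: real ^ 'd)"

definition is_implicit_grid_graph ::
    "nat \<Rightarrow> nat \<Rightarrow> real \<Rightarrow> (nat ^ 'd) implicit_graph \<Rightarrow> bool" where
  "is_implicit_grid_graph k b c G \<longleftrightarrow>
     is_implicit_graph k b G \<and>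
     (\<forall>(u, v) \<in> edges G. 0 < grid_dist u v \<and> grid_dist u v \<le> c)"

text \<open>
  \<open>K1\<close>, \<open>K2\<close>, \<open>K3\<close> are the constants hidden in \<open>|S| \<in> O(c |V| / s\<^sup>1\<^sup>/\<^sup>d log s)\<close>, \<open>h \<in> O(|V| / s)\<close>
  and \<open>|V\<^sub>i| \<in> O(s)\<close>; the base of the logarithm is absorbed in \<open>K1\<close>. The dimension \<open>d\<close> is
  \<open>CARD('d)\<close>. The inclusion \<open>V\<^sub>i \<subset> V\<close> is proper.
\<close>

definition pseudo_separator ::
    "real \<Rightarrow> real \<Rightarrow> real \<Rightarrow> real \<Rightarrow> real \<Rightarrow> (nat ^ 'd) implicit_graph \<Rightarrow> (nat ^ 'd) set \<Rightarrow> bool" where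
  "pseudo_separator K1 K2 K3 c s G S \<longleftrightarrow>
     S \<subseteq> nodes G \<and>
     real (card S) \<le> K1 * (c * real (card (nodes G)) / s powr (1 / real CARD('d)) * ln s) \<and>
     (\<exists>(h :: nat) (Vs :: nat \<Rightarrow> (nat ^ 'd) set).
        real h \<le> K2 * (real (card (nodes G)) / s) \<and>
        nodes G - S = (\<Union>i \<in> {1..h}. Vs i) \<and>
        disjoint_family_on Vs {1..h} \<and>
        (\<forall>i \<in> {1..h}. Vs i \<subset> nodes G \<and> real (card (Vs i)) \<le> K3 * s) \<and>
        (\<forall>i \<in> {1..h}. \<forall>j \<in> {1..h}. i \<noteq> j \<longrightarrow> edges G \<inter> (Vs i \<times> Vs j) = {}))"

end

theory Submission
  imports Defs "HOL-Number_Theory.Cong"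
begin

text \<open>
  Nodes are distinct lattice points, so a box of side \<open>L = \<lfloor>s\<^sup>1\<^sup>/\<^sup>d\<rfloor>\<close> holds at most
  \<open>L\<^sup>d \<le> s\<close> of them. Cut the lattice into such boxes and delete the strips of width \<open>\<lfloor>c\<rfloor>\<close> at the
  lower faces of the boxes; what remains has no edge between different boxes. Averaging over the
  \<open>L\<close> diagonal translates of the subdivision gives one that deletes at most \<open>d c |V| / L\<close> nodes.
  Finally the boxes are packed greedily into at most \<open>2 |V| / s + 1\<close> groups of at most \<open>s\<close> nodes.
\<close>

section \<open>Averaging over diagonal translates\<close>

text \<open>Cancelling \<open>x\<close> modulo \<open>L\<close>, distinct shifts below
  \<open>L\<close> give distinct residues, so each of the \<open>w\<close> residues below
  \<open>w\<close> is hit at most once.\<close>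

lemma card_shifts_mod_less:
  fixes x L w :: nat
  shows "card {a \<in> {..<L}. (x + a) mod L < w} \<le> w"
proof -
  have inj: "inj_on (\<lambda>a. (x + a) mod L) {a \<in> {..<L}. (x + a) mod L < w}"
  proof (rule inj_onI)
    fix a b assume a: "a \<in> {a \<in> {..<L}. (x + a) mod L < w}"
      and b: "b \<in> {a \<in> {..<L}. (x + a) mod L < w}" and eq: "(x + a) mod L = (x + b) mod L"
    have "a mod L = b mod L"
      using eq by (metis cong_def cong_add_lcancel_nat)
    then show "a = b" using a b by simp
  qed
  have "card {a \<in> {..<L}. (x + a) mod L < w} \<le> card {..<w}"
    by (rule card_inj_on_le[OF inj]) auto
  then show ?thesis by simp
qed

text \<open>Double counting: per coordinate, a node lies in the strips of at most \<open>w\<close>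
  shifts, so some shift does no worse than the average. Multiplying by \<open>L\<close> keeps the
  bound in the naturals.\<close>

lemma exists_sparse_shift:
  fixes A :: "(nat ^ 'd) set" and L w :: nat
  assumes "finite A" and "0 < L"
  shows "\<exists>a<L. card {v \<in> A. \<exists>i. (v $ i + a) mod L < w} * L \<le> CARD('d) * card A * w"
proof (rule ccontr)
  define S where "S a = {v \<in> A. \<exists>i. (v $ i + a) mod L < w}" for a
  define T where "T a i = {v \<in> A. (v $ i + a) mod L < w}" for a and i :: 'd
  assume "\<not> ?thesis"
  then have *: "CARD('d) * card A * w < card (S a) * L" if "a < L" for a
    using that by (auto simp: S_def not_le)
  have "card (S a) \<le> (\<Sum>i\<in>UNIV. card (T a i))" for a
  proof -
    have "S a = (\<Union>i. T a i)" by (auto simp: S_def T_def)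
    then show ?thesis using card_UN_le[of UNIV "T a"] by simp
  qed
  then have "(\<Sum>a<L. card (S a)) \<le> (\<Sum>a<L. \<Sum>i\<in>UNIV. card (T a i))"
    by (rule sum_mono)
  also have "\<dots> = (\<Sum>i\<in>UNIV. \<Sum>a<L. card (T a i))" by (rule sum.swap)
  \<comment> \<open>For a fixed coordinate, pairs of a shift and a deleted node are now counted by
    node.\<close>
  also have "\<dots> = (\<Sum>i::'d\<in>UNIV. \<Sum>v\<in>A. card {a \<in> {..<L}. (v $ i + a) mod L < w})"
    unfolding T_def using assms(1)
    by (intro sum.cong refl sum_multicount_gen) auto
  also have "\<dots> \<le> (\<Sum>i::'d\<in>UNIV. \<Sum>v\<in>A. w)"
    by (intro sum_mono card_shifts_mod_less)
  finally have le: "(\<Sum>a<L. card (S a)) \<le> CARD('d) * card A * w" by simp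
  have "(\<Sum>a<L. CARD('d) * card A * w) < (\<Sum>a<L. card (S a) * L)"
    using * assms(2) by (intro sum_strict_mono) auto
  then have "L * (CARD('d) * card A * w) < (\<Sum>a<L. card (S a)) * L"
    by (simp only: sum_distrib_right sum_constant card_lessThan of_nat_id)
  then show False using le by (simp add: mult.commute[of L])
qed

section \<open>Capacity and separation of boxes\<close>

text \<open>Quotient and remainder determine a coordinate, so inside one box the vector of residues
  identifies the point.\<close>

lemma card_box_le:
  fixes A :: "(nat ^ 'd) set" and q :: "nat ^ 'd"
  assumes "0 < L"
  shows "card {v \<in> A. (\<chi> i. (v $ i + a) div L) = q} \<le> L ^ CARD('d)"
proof -
  let ?B = "{v \<in> A. (\<chi> i. (v $ i + a) div L) = q}"
  let ?r = "\<lambda>v::nat^'d. (\<lambda>i. (v $ i + a) mod L)"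
  have inj: "inj_on ?r ?B"
  proof (rule inj_onI)
    fix u v assume u: "u \<in> ?B" and v: "v \<in> ?B" and eq: "?r u = ?r v"
    have "u $ i = v $ i" for i
    proof -
      have "(u $ i + a) div L = (v $ i + a) div L"
        using u v by (auto simp: vec_eq_iff)
      moreover have "(u $ i + a) mod L = (v $ i + a) mod L" using eq by meson
      ultimately show ?thesis by (metis add_right_cancel div_mult_mod_eq)
    qed
    then show "u = v" by (simp add: vec_eq_iff)
  qed
  have "card ?B \<le> card (PiE (UNIV :: 'd set) (\<lambda>_. {..<L}))"
    by (rule card_inj_on_le[OF inj]) (use assms in \<open>auto intro!: finite_PiE\<close>)
  then show ?thesis by (simp add: card_PiE)
qed

lemma grid_dist_component_le: "\<bar>real (u $ i) - real (v $ i)\<bar> \<le> grid_dist u v"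
  using component_le_infnorm_cart[of "(\<chi> i. real (u $ i) - real (v $ i))" i]
  by (simp add: grid_dist_def)

text \<open>The start \<open>L * (y div L)\<close> of the interval of \<open>y\<close> lies strictly
  above \<open>x\<close> and at least \<open>w\<close> below \<open>y\<close>.\<close>

lemma diff_ge_if_div_less:
  fixes x y L w :: nat
  assumes "x div L < y div L" and "w \<le> y mod L"
  shows "x + w < y"
proof -
  have L: "0 < L" using assms(1) by (cases L) auto
  have "x < L * (x div L + 1)" using L by (simp add: dividend_less_times_div)
  also have "\<dots> \<le> L * (y div L)" using assms(1) by (intro mult_le_mono2) simp
  finally show ?thesis using assms(2) mult_div_mod_eq[of L y] by linarith
qed

lemma grid_dist_gt_if_boxes_differ:
  fixes u v :: "nat ^ 'd"
  assumes "\<forall>i. \<not> (u $ i + a) mod L < nat \<lfloor>c\<rfloor>" and "\<forall>i. \<not> (v $ i + a) mod L < nat \<lfloor>c\<rfloor>"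
    and "(\<chi> i. (u $ i + a) div L) \<noteq> (\<chi> i. (v $ i + a) div L)"
  shows "c < grid_dist u v"
proof -
  obtain i where "(u $ i + a) div L \<noteq> (v $ i + a) div L"
    using assms(3) by (auto simp: vec_eq_iff)
  then have "u $ i + a + nat \<lfloor>c\<rfloor> < v $ i + a \<or> v $ i + a + nat \<lfloor>c\<rfloor> < u $ i + a"
    using assms(1,2) diff_ge_if_div_less by (metis linorder_neqE_nat not_less)
  \<comment> \<open>The strict inequality gives an integer gap of at least
    \<open>\<lfloor>c\<rfloor> + 1\<close>, which exceeds the real \<open>c\<close>.\<close>
  then have "c < \<bar>real (u $ i) - real (v $ i)\<bar>" by linarith
  then show ?thesis using grid_dist_component_le[of u i v] by simp
qed

section \<open>Greedy packing\<close>

text \<open>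
  Bin \<open>0\<close> is kept at most half full. When a new item would overfill it, bin \<open>0\<close> and the item
  together become a new bin, which is more than half full.
\<close>

lemma bin_packing_aux:
  fixes f :: "'a \<Rightarrow> real"
  assumes "finite C" and "\<forall>x\<in>C. 0 \<le> f x \<and> f x \<le> s" and "0 < s"
  shows "\<exists>(h :: nat) g. (\<forall>x\<in>C. g x \<le> h) \<and>
    (\<forall>i. (\<Sum>x\<in>C. if g x = i then f x else 0) \<le> s) \<and>
    (\<Sum>x\<in>C. if g x = 0 then f x else 0) \<le> s / 2 \<and>
    real h * s + 2 * (\<Sum>x\<in>C. if g x = 0 then f x else 0) \<le> 2 * sum f C"
  using assms(1,2)
proof (induction C rule: finite_induct)
  case empty
  then show ?case using assms(3) by (intro exI[of _ 0]) auto
next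
  case (insert y C)
  define load where "load g i = (\<Sum>x\<in>C. if g x = i then f x else 0)" for g and i :: nat
  obtain h g where g: "\<forall>x\<in>C. g x \<le> h" "\<And>i. load g i \<le> s" "load g 0 \<le> s / 2"
    "real h * s + 2 * load g 0 \<le> 2 * sum f C"
    using insert unfolding load_def by auto
  have y: "0 \<le> f y" "f y \<le> s" using insert by auto
  have split: "(\<Sum>x\<in>insert y C. if g' x = i then f x else 0)
      = (if g' y = i then f y else 0) + load g' i" for g' i
    using insert by (simp add: load_def)
  have empty_bin: "load g (Suc h) = 0"
    using g(1) unfolding load_def by (intro sum.neutral) auto
  have total: "sum f (insert y C) = f y + sum f C" using insert by simp
  \<comment> \<open>An item above \<open>s / 2\<close> gets a bin of its own, as merging it with bin
    \<open>0\<close> could exceed \<open>s\<close>. In the merge case the joint load lies between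
    \<open>s / 2\<close> and \<open>s\<close>. Either way the new bin pays for its \<open>s\<close>
    in the last conjunct with twice its load.\<close>
  consider (small) "load g 0 + f y \<le> s / 2" | (large) "s / 2 < f y"
    | (merge) "f y \<le> s / 2" "s / 2 < load g 0 + f y" by linarith
  then show ?case
  proof cases
    case small
    define g' where "g' = g(y := 0)"
    have upd: "load g' i = load g i" for i
      using insert unfolding load_def g'_def by (intro sum.cong) auto
    have "g' y = 0" "\<forall>x\<in>C. g' x \<le> h" using g(1) by (auto simp: g'_def)
    then show ?thesis
      using g(2-4) small assms(3)
      by (intro exI[of _ h] exI[of _ g'])
        (auto simp: split upd total algebra_simps simp del: sum.insert)
  next
    case large
    define g' where "g' = g(y := Suc h)"
    have upd: "load g' i = load g i" for i
      using insert unfolding load_def g'_def by (intro sum.cong) auto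
    have "g' y = Suc h" "\<forall>x\<in>C. g' x \<le> Suc h" using g(1) by (auto simp: g'_def)
    then show ?thesis
      using g(2-4) y large empty_bin
      by (intro exI[of _ "Suc h"] exI[of _ g'])
        (auto simp: split upd total algebra_simps simp del: sum.insert)
  next
    case merge
    \<comment> \<open>Relabelling empties bin \<open>0\<close> into the fresh bin
      \<open>Suc h\<close> together with \<open>y\<close>.\<close>
    define g' where "g' x = (if x = y \<or> g x = 0 then Suc h else g x)" for x
    have zero: "load g' 0 = 0" unfolding load_def g'_def by (intro sum.neutral) auto
    have new: "load g' (Suc h) = load g 0"
      unfolding load_def g'_def using g(1) insert by (intro sum.cong) auto
    have old: "load g' i = load g i" if "i \<noteq> 0" "i \<noteq> Suc h" for i
      unfolding load_def g'_def using insert that by (intro sum.cong) auto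
    have "load g' i \<le> s" if "i \<noteq> Suc h" for i
      using zero old[of i] g(2)[of i] assms(3) that by (cases "i = 0") auto
    moreover have "f y + load g 0 \<le> s" using merge g(3) by simp
    moreover have "g' y = Suc h" "\<forall>x\<in>C. g' x \<le> Suc h" using g(1) by (auto simp: g'_def)
    ultimately show ?thesis
      using g(4) merge zero new assms(3)
      by (intro exI[of _ "Suc h"] exI[of _ g'])
        (auto simp: split total algebra_simps simp del: sum.insert)
  qed
qed

text \<open>The items packed are the fibers of \<open>q\<close>, weighted by size, so no fiber is
  split. The bins are \<open>0\<close> to \<open>h\<close>, which makes \<open>h + 1\<close>
  groups.\<close>

lemma pack_fibers:
  fixes A :: "'a set" and q :: "'a \<Rightarrow> 'b"
  assumes "finite A" and "0 < s" and "\<And>x. real (card {v \<in> A. q v = x}) \<le> s"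
  shows "\<exists>(h :: nat) g. (\<forall>v\<in>A. g (q v) \<le> h) \<and>
    (\<forall>i. real (card {v \<in> A. g (q v) = i}) \<le> s) \<and> real h * s \<le> 2 * real (card A)"
proof -
  define f where "f x = real (card {v \<in> A. q v = x})" for x
  \<comment> \<open>With \<open>P x\<close> as \<open>g x = i\<close> this turns bin loads into node
    counts; with \<open>P\<close> constantly true it gives the total.\<close>
  have fib: "(\<Sum>x\<in>q ` A. if P x then f x else 0) = real (card {v \<in> A. P (q v)})" for P
  proof -
    have "(\<Sum>x\<in>q ` A. if P x then f x else 0)
        = (\<Sum>x\<in>q ` A. \<Sum>v\<in>{v \<in> A. q v = x}. if P (q v) then 1 else 0)"
      by (intro sum.cong) (auto simp: f_def)
    also have "\<dots> = (\<Sum>v\<in>A. if P (q v) then 1 else 0)"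
      using assms(1) by (intro sum.group) auto
    also have "\<dots> = real (card {v \<in> A. P (q v)})"
      using assms(1) by (simp add: sum.If_cases Int_def)
    finally show ?thesis .
  qed
  have "\<exists>(h :: nat) g. (\<forall>x\<in>q ` A. g x \<le> h) \<and>
    (\<forall>i. (\<Sum>x\<in>q ` A. if g x = i then f x else 0) \<le> s) \<and>
    (\<Sum>x\<in>q ` A. if g x = 0 then f x else 0) \<le> s / 2 \<and>
    real h * s + 2 * (\<Sum>x\<in>q ` A. if g x = 0 then f x else 0) \<le> 2 * sum f (q ` A)"
    using assms by (intro bin_packing_aux) (auto simp: f_def)
  moreover have "sum f (q ` A) = real (card A)" using fib[of "\<lambda>_. True"] by simp
  ultimately obtain h g where "\<forall>x\<in>q ` A. g x \<le> h"
    and "\<forall>i. real (card {v \<in> A. g (q v) = i}) \<le> s"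
    and "real (h::nat) * s + 2 * real (card {v \<in> A. g (q v) = 0}) \<le> 2 * real (card A)"
    unfolding fib by auto
  then show ?thesis by (intro exI[of _ h] exI[of _ g]) auto
qed

section \<open>Choice of separator and constants\<close>

text \<open>The factor \<open>K * ln s\<close> absorbs \<open>2 * d\<close>: the \<open>d\<close>
  comes from the coordinates, the \<open>2\<close> from rounding \<open>s powr (1 / d)\<close> down
  to \<open>L\<close>.\<close>

lemma pseudo_separator_exists:
  fixes G :: "(nat ^ 'd) implicit_graph"
  assumes fin: "finite (nodes G)"
    and short: "\<And>u v. (u, v) \<in> edges G \<Longrightarrow> grid_dist u v \<le> c"
    and c: "0 \<le> c" and s: "1 \<le> s" "s < real (card (nodes G))"
    and K: "2 * real CARD('d) \<le> K * ln s"
  shows "\<exists>S. pseudo_separator K 3 1 c s G S"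
proof -
  let ?V = "nodes G" and ?d = "CARD('d)" and ?n = "card (nodes G)"
  define t where "t = s powr (1 / real ?d)"
  define L where "L = nat \<lfloor>t\<rfloor>"
  define w where "w = nat \<lfloor>c\<rfloor>"
  have t: "1 \<le> t" using s(1) by (simp add: t_def ge_one_powr_ge_zero)
  have "1 \<le> \<lfloor>t\<rfloor>" "real L = of_int \<lfloor>t\<rfloor>" using t by (auto simp: L_def)
  \<comment> \<open>The last bound holds because \<open>t < L + 1\<close> and
    \<open>1 \<le> L\<close>.\<close>
  then have L: "0 < L" "real L \<le> t" "t \<le> 2 * real L" by linarith+
  have w: "real w \<le> c" using c by (simp add: w_def)
  have "t ^ ?d = s"
    using s(1) by (simp add: t_def powr_realpow[symmetric] powr_powr)
  then have Ls: "real (L ^ ?d) \<le> s"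
    using power_mono[OF L(2), of ?d] by simp
  obtain a where a: "card {v \<in> ?V. \<exists>i. (v $ i + a) mod L < w} * L \<le> ?d * ?n * w"
    using exists_sparse_shift[OF fin L(1), of w] by blast
  define S where "S = {v \<in> ?V. \<exists>i. (v $ i + a) mod L < w}"
  define q where "q v = (\<chi> i. (v $ i + a) div L)" for v :: "nat ^ 'd"
  have "real (card S) * t \<le> real (card S) * (2 * real L)"
    using L by (intro mult_left_mono) auto
  also have "\<dots> = 2 * real (card S * L)" by simp
  also have "\<dots> \<le> 2 * real (?d * ?n * w)" using a unfolding S_def by linarith
  also have "\<dots> = 2 * real ?d * (real ?n * real w)" by simp
  also have "\<dots> \<le> 2 * real ?d * (real ?n * c)" using w by (intro mult_left_mono) auto
  also have "\<dots> \<le> K * ln s * (real ?n * c)" using K c by (intro mult_right_mono) auto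
  finally have cardS: "real (card S) \<le> K * (c * real ?n / t * ln s)"
    using t by (simp add: field_simps)
  have fibers: "real (card {v \<in> ?V - S. q v = x}) \<le> s" for x
    using card_box_le[OF L(1), of "?V - S" a x] Ls unfolding q_def by linarith
  obtain h g where g: "\<forall>v\<in>?V - S. g (q v) \<le> h"
      "\<forall>i. real (card {v \<in> ?V - S. g (q v) = i}) \<le> s"
      "real (h::nat) * s \<le> 2 * real (card (?V - S))"
    using pack_fibers[of "?V - S" s q] fin fibers s(1) by auto
  \<comment> \<open>\<open>Suc\<close> moves the bins \<open>0\<close> to \<open>h\<close> to the
    indices \<open>1\<close> to \<open>Suc h\<close>.\<close>
  define Vs where "Vs i = {v \<in> ?V - S. Suc (g (q v)) = i}" for i
  have "real (card (?V - S)) \<le> real ?n" using fin by (simp add: card_mono)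
  \<comment> \<open>The extra bin costs one more \<open>s\<close>, which is below
    \<open>|V|\<close>; hence the constant \<open>3\<close>.\<close>
  then have "real (Suc h) * s \<le> 3 * real ?n" using g(3) s(2) by (simp add: algebra_simps)
  then have h: "real (Suc h) \<le> 3 * (real ?n / s)" using s(1) by (simp add: field_simps)
  have cardVs: "real (card (Vs i)) \<le> s" for i
  proof (cases i)
    case 0
    then have "Vs i = {}" by (simp add: Vs_def)
    then show ?thesis using s(1) by simp
  next
    case (Suc j)
    then show ?thesis using g(2) by (simp add: Vs_def)
  qed
  have proper: "Vs i \<subset> ?V" for i
  proof
    show "Vs i \<subseteq> ?V" by (auto simp: Vs_def)
    show "Vs i \<noteq> ?V" using cardVs[of i] s(2) by auto
  qed
  have cut: "edges G \<inter> (Vs i \<times> Vs j) = {}" if "i \<noteq> j" for i j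
  proof -
    have "(u, v) \<notin> edges G" if "u \<in> Vs i" "v \<in> Vs j" for u v
    proof -
      \<comment> \<open>Groups are unions of whole boxes, so nodes in different groups lie in
        different boxes.\<close>
      have "q u \<noteq> q v" using that \<open>i \<noteq> j\<close> by (auto simp: Vs_def)
      moreover have "\<forall>i. \<not> (u $ i + a) mod L < w" "\<forall>i. \<not> (v $ i + a) mod L < w"
        using that by (auto simp: Vs_def S_def)
      ultimately have "c < grid_dist u v"
        using grid_dist_gt_if_boxes_differ unfolding w_def q_def by blast
      then show ?thesis using short[of u v] by auto
    qed
    then show ?thesis by auto
  qed
  have "pseudo_separator K 3 1 c s G S"
    unfolding pseudo_separator_def
  proof (intro conjI exI[of _ "Suc h"] exI[of _ Vs])
    show "S \<subseteq> ?V" by (auto simp: S_def)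
    show "real (card S) \<le> K * (c * real ?n / s powr (1 / real ?d) * ln s)"
      using cardS by (simp add: t_def)
    show "?V - S = (\<Union>i \<in> {1..Suc h}. Vs i)" using g(1) by (auto simp: Vs_def)
    show "disjoint_family_on Vs {1..Suc h}" by (auto simp: disjoint_family_on_def Vs_def)
  qed (use h cardVs proper cut in auto)
  then show ?thesis ..
qed

theorem theorem9:
  fixes \<alpha> :: real
  assumes "2 \<le> CARD('d :: finite)" and "0 < \<alpha>" and "\<alpha> < 1"
  shows "\<exists>K1 > 0. \<exists>K2 > 0. \<exists>K3 > 0.
    \<forall>(k :: nat) (b :: nat) (c :: real) (s :: real) (G :: (nat ^ 'd) implicit_graph).
      is_implicit_grid_graph k b c G \<longrightarrow>
      s = real (card (nodes G)) powr \<alpha> \<longrightarrow>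
      1 \<le> c \<longrightarrow> c \<le> s powr (1 / real (CARD('d) ^ 3)) \<longrightarrow>
      real (card (nodes G)) > s \<longrightarrow>
      (\<exists>S. pseudo_separator K1 K2 K3 c s G S)"
proof -
  \<comment> \<open>Chosen so that \<open>|V| \<ge> 2\<close>, that is
    \<open>ln s \<ge> \<alpha> * ln 2\<close>, yields \<open>2 * d \<le> K * ln s\<close>.\<close>
  define K where "K = 2 * real CARD('d) / (\<alpha> * ln 2)"
  have K: "0 < K" using assms(2) by (simp add: K_def)
  have "\<exists>S. pseudo_separator K 3 1 c s G S"
    if G: "is_implicit_grid_graph k b c G" and s: "s = real (card (nodes G)) powr \<alpha>"
      and c: "1 \<le> c" and n: "s < real (card (nodes G))"
    for k b c s and G :: "(nat ^ 'd) implicit_graph"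
  proof -
    \<comment> \<open>Both \<open>0\<close> and \<open>1\<close> are fixed by
      \<open>powr \<alpha>\<close>, contradicting \<open>s < |V|\<close>.\<close>
    have "card (nodes G) \<noteq> 0" using n s by (intro notI) simp
    moreover have "card (nodes G) \<noteq> 1" using n s by (intro notI) simp
    ultimately have n2: "2 \<le> real (card (nodes G))" by linarith
    have "\<alpha> * ln 2 \<le> \<alpha> * ln (real (card (nodes G)))"
      using n2 assms(2) by (intro mult_left_mono) auto
    also have "\<dots> = ln s" using n2 s by (simp add: ln_powr)
    finally have "K * (\<alpha> * ln 2) \<le> K * ln s" using K by (intro mult_left_mono) auto
    then have "2 * real CARD('d) \<le> K * ln s" using assms(2) by (simp add: K_def)
    moreover have "1 \<le> s" using s n2 assms(2) by (simp add: ge_one_powr_ge_zero)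
    ultimately show ?thesis
      using G c n by (intro pseudo_separator_exists)
        (auto simp: is_implicit_grid_graph_def is_implicit_graph_def)
  qed
  then show ?thesis
    using K zero_less_numeral[where 'a = real] zero_less_one[where 'a = real] by blast
qed

end
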